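(* Let $M$ be an ordered $\Gamma$-semigroup. Then $M$ is intra-regular if and only if every ideal of $M$ is semiprime.
   Context: A $\Gamma$-semigroup consists of nonempty sets $M$ and $\Gamma$ and a well-defined operation $M\times\Gamma\times M\to M$, $(a,\gamma,b)\mapsto a\gamma b$, with $a\gamma(b\mu c)=(a\gamma b)\mu c$ for all $a,b,c\in M$, $\gamma,\mu\in\Gamma$. An ordered $\Gamma$-semigroup ($po$-$\Gamma$-semigroup) is a $\Gamma$-semigroup $M$ with a partial order $\le$ on $M$ such that $a\le b$ implies $a\gamma c\le b\gamma c$ and $c\gamma a\le c\gamma b$ for all $c\in M$, $\gamma\in\Gamma$. Notation: for $A,B\subseteq M$, $A\Gamma B=\{a\gamma b\mid a\in A,\ b\in B,\ \gamma\in\Gamma\}$. For fixed $x\in M$, $\gamma\in\Gamma$, $M\Gamma x\gamma x\Gamma M=\{u\lambda (x\gamma x)\mu v\mid u,v\in M,\ \lambda,\mu\in\Gamma\}$. For $H\subseteq M$, $(H]=\{t\in M\mid t\le h\text{ for some }h\in H\}$. $M$ is intra-regular if $x\in (M\Gamma x\gamma x\Gamma M]$ for every $x\in M$ and every $\gamma\in\Gamma$. A left (resp. right) ideal of $M$ is a nonempty subset $A\subseteq M$ such that (1) $M\Gamma A\subseteq A$ (resp. $A\Gamma M\subseteq A$) and (2) if $a\in A$ and $b\in M$ with $b\le a$, then $b\in A$. An ideal of $M$ is a subset that is both a left and a right ideal. A subset $T\subseteq M$ is semiprime if for every $x\in M$ and every $\gamma\in\Gamma$ with $x\gamma x\in T$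 we have $x\in T$. *)

theory Defs
  imports Main
begin

text \<open>
  Both \<open>M\<close> and \<open>\<Gamma>\<close> are carrier sets; \<open>mul a g b\<close> is the product \<open>a \<gamma> b\<close>. The operation is
  total on the ambient types, and its values outside \<open>M \<times> \<Gamma> \<times> M\<close> are irrelevant.
\<close>

locale gamma_semigroup =
  fixes M :: "'a set"
    and \<Gamma> :: "'g set"
    and mul :: "'a \<Rightarrow> 'g \<Rightarrow> 'a \<Rightarrow> 'a"
  assumes M_nonempty: "M \<noteq> {}"
    and Gamma_nonempty: "\<Gamma> \<noteq> {}"
    and mul_closed: "\<lbrakk>a \<in> M; g \<in> \<Gamma>; b \<in> M\<rbrakk> \<Longrightarrow> mul a g b \<in> M"
    and mul_assoc: "\<lbrakk>a \<in> M; b \<in> M; c \<in> M; g \<in> \<Gamma>; h \<in> \<Gamma>\<rbrakk>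
      \<Longrightarrow> mul a g (mul b h c) = mul (mul a g b) h c"

text \<open>The order is a relation \<open>r\<close>, where \<open>(a, b) \<in> r\<close> stands for \<open>a \<le> b\<close>.\<close>

locale ordered_gamma_semigroup = gamma_semigroup M \<Gamma> mul
  for M :: "'a set"
    and \<Gamma> :: "'g set"
    and mul :: "'a \<Rightarrow> 'g \<Rightarrow> 'a \<Rightarrow> 'a" +
  fixes r :: "('a \<times> 'a) set"
  assumes order: "partial_order_on M r"
    and mul_mono_left: "\<lbrakk>a \<in> M; b \<in> M; c \<in> M; g \<in> \<Gamma>; (a, b) \<in> r\<rbrakk>
      \<Longrightarrow> (mul a g c, mul b g c) \<in> r"
    and mul_mono_right: "\<lbrakk>a \<in> M; b \<in> M; c \<in> M; g \<in> \<Gamma>; (a, b) \<in> r\<rbrakk>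
      \<Longrightarrow> (mul c g a, mul c g b) \<in> r"

definition gamma_prod :: "'g set \<Rightarrow> ('a \<Rightarrow> 'g \<Rightarrow> 'a \<Rightarrow> 'a) \<Rightarrow> 'a set \<Rightarrow> 'a set \<Rightarrow> 'a set"
  where "gamma_prod \<Gamma> mul A B = {mul a g b | a g b. a \<in> A \<and> g \<in> \<Gamma> \<and> b \<in> B}"

definition down_closure :: "'a set \<Rightarrow> ('a \<times> 'a) set \<Rightarrow> 'a set \<Rightarrow> 'a set"
  where "down_closure M r H = {t \<in> M. \<exists>h\<in>H. (t, h) \<in> r}"

definition intra_regular ::
    "'a set \<Rightarrow> 'g set \<Rightarrow> ('a \<Rightarrow> 'g \<Rightarrow> 'a \<Rightarrow> 'a) \<Rightarrow> ('a \<times> 'a) set \<Rightarrow> bool"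
  where "intra_regular M \<Gamma> mul r \<longleftrightarrow>
    (\<forall>x\<in>M. \<forall>g\<in>\<Gamma>.
      x \<in> down_closure M r
        {mul (mul u l (mul x g x)) m v | u l m v. u \<in> M \<and> l \<in> \<Gamma> \<and> m \<in> \<Gamma> \<and> v \<in> M})"

definition left_ideal ::
    "'a set \<Rightarrow> 'g set \<Rightarrow> ('a \<Rightarrow> 'g \<Rightarrow> 'a \<Rightarrow> 'a) \<Rightarrow> ('a \<times> 'a) set \<Rightarrow> 'a set \<Rightarrow> bool"
  where "left_ideal M \<Gamma> mul r A \<longleftrightarrow>
    A \<noteq> {} \<and> A \<subseteq> M \<and> gamma_prod \<Gamma> mul M A \<subseteq> A \<and>
    (\<forall>a\<in>A. \<forall>b\<in>M. (b, a) \<in> r \<longrightarrow> b \<in> A)"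

definition right_ideal ::
    "'a set \<Rightarrow> 'g set \<Rightarrow> ('a \<Rightarrow> 'g \<Rightarrow> 'a \<Rightarrow> 'a) \<Rightarrow> ('a \<times> 'a) set \<Rightarrow> 'a set \<Rightarrow> bool"
  where "right_ideal M \<Gamma> mul r A \<longleftrightarrow>
    A \<noteq> {} \<and> A \<subseteq> M \<and> gamma_prod \<Gamma> mul A M \<subseteq> A \<and>
    (\<forall>a\<in>A. \<forall>b\<in>M. (b, a) \<in> r \<longrightarrow> b \<in> A)"

definition gamma_ideal ::
    "'a set \<Rightarrow> 'g set \<Rightarrow> ('a \<Rightarrow> 'g \<Rightarrow> 'a \<Rightarrow> 'a) \<Rightarrow> ('a \<times> 'a) set \<Rightarrow> 'a set \<Rightarrow> bool"
  where "gamma_ideal M \<Gamma> mul r A \<longleftrightarrow>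
    left_ideal M \<Gamma> mul r A \<and> right_ideal M \<Gamma> mul r A"

definition semiprime :: "'a set \<Rightarrow> 'g set \<Rightarrow> ('a \<Rightarrow> 'g \<Rightarrow> 'a \<Rightarrow> 'a) \<Rightarrow> 'a set \<Rightarrow> bool"
  where "semiprime M \<Gamma> mul T \<longleftrightarrow> (\<forall>x\<in>M. \<forall>g\<in>\<Gamma>. mul x g x \<in> T \<longrightarrow> x \<in> T)"

end

theory Submission
  imports Defs
begin

text \<open>
  The set \<open>J = (M\<Gamma>x\<gamma>x\<Gamma>M]\<close> is an ideal containing
  \<open>(x\<gamma>x)\<gamma>(x\<gamma>x) = x\<gamma>(x\<gamma>x)\<gamma>x\<close>. If \<open>J\<close> is semiprime, then \<open>x\<gamma>x \<in> J\<close>, hence \<open>x \<in> J\<close>.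
\<close>

context ordered_gamma_semigroup
begin

text \<open>This is the set M\<Gamma>p\<Gamma>M. The middle factor is an arbitrary \<open>p\<close>
  because closure under multiplication does not depend on \<open>p\<close> being a square;
  intra-regularity takes \<open>p\<close> to be \<open>mul x g x\<close>.\<close>

definition two_sided_multiples :: "'a \<Rightarrow> 'a set"
  where "two_sided_multiples p =
    {mul (mul u l p) m v | u l m v. u \<in> M \<and> l \<in> \<Gamma> \<and> m \<in> \<Gamma> \<and> v \<in> M}"

lemma order_refl: "a \<in> M \<Longrightarrow> (a, a) \<in> r"
  using order unfolding partial_order_on_def preorder_on_def by (simp add: refl_on_def)

lemma order_trans: "\<lbrakk>(a, b) \<in> r; (b, c) \<in> r\<rbrakk> \<Longrightarrow> (a, c) \<in> r"
  using order unfolding partial_order_on_def preorder_on_def by (meson transD)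

lemma two_sided_multiplesI:
  "\<lbrakk>u \<in> M; l \<in> \<Gamma>; m \<in> \<Gamma>; v \<in> M\<rbrakk> \<Longrightarrow> mul (mul u l p) m v \<in> two_sided_multiples p"
  unfolding two_sided_multiples_def by blast

lemma two_sided_multiplesE:
  assumes "h \<in> two_sided_multiples p"
  obtains u l m v where "u \<in> M" "l \<in> \<Gamma>" "m \<in> \<Gamma>" "v \<in> M" "h = mul (mul u l p) m v"
  using assms unfolding two_sided_multiples_def by blast

lemma two_sided_multiples_subset: "p \<in> M \<Longrightarrow> two_sided_multiples p \<subseteq> M"
  unfolding two_sided_multiples_def by (auto simp: mul_closed)

text \<open>Associativity absorbs \<open>w\<close> into the outer left factor: \<open>u\<close>
  becomes \<open>mul w g u\<close>, while \<open>p\<close> and the right factor stay as they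
  are.\<close>

lemma two_sided_multiples_mul_left:
  assumes "p \<in> M" "w \<in> M" "g \<in> \<Gamma>" "h \<in> two_sided_multiples p"
  shows "mul w g h \<in> two_sided_multiples p"
proof -
  obtain u l m v where uv: "u \<in> M" "l \<in> \<Gamma>" "m \<in> \<Gamma>" "v \<in> M"
    and h: "h = mul (mul u l p) m v"
    using assms(4) by (rule two_sided_multiplesE)
  have "mul w g h = mul (mul (mul w g u) l p) m v"
    using assms(1-3) uv h by (simp add: mul_assoc mul_closed)
  then show ?thesis
    using assms(2,3) uv by (simp add: two_sided_multiplesI mul_closed)
qed

lemma two_sided_multiples_mul_right:
  assumes "p \<in> M" "w \<in> M" "g \<in> \<Gamma>" "h \<in> two_sided_multiples p"
  shows "mul h g w \<in> two_sided_multiples p"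
proof -
  obtain u l m v where uv: "u \<in> M" "l \<in> \<Gamma>" "m \<in> \<Gamma>" "v \<in> M"
    and h: "h = mul (mul u l p) m v"
    using assms(4) by (rule two_sided_multiplesE)
  have "mul h g w = mul (mul u l p) m (mul v g w)"
    using assms(1-3) uv h by (simp add: mul_assoc mul_closed)
  then show ?thesis
    using assms(2,3) uv by (simp add: two_sided_multiplesI mul_closed)
qed

text \<open>Absorption passes from \<open>H\<close> to its down-closure because multiplication is
  monotone on both sides; transitivity makes the result downward closed, and reflexivity makes it
  nonempty.\<close>

lemma gamma_ideal_down_closure:
  assumes "H \<subseteq> M" "H \<noteq> {}"
    and left: "\<And>w g h. \<lbrakk>w \<in> M; g \<in> \<Gamma>; h \<in> H\<rbrakk> \<Longrightarrow> mul w g h \<in> H"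
    and right: "\<And>w g h. \<lbrakk>w \<in> M; g \<in> \<Gamma>; h \<in> H\<rbrakk> \<Longrightarrow> mul h g w \<in> H"
  shows "gamma_ideal M \<Gamma> mul r (down_closure M r H)"
proof -
  let ?J = "down_closure M r H"
  have "?J \<noteq> {}" "?J \<subseteq> M"
    using assms(1,2) unfolding down_closure_def by (auto intro: order_refl)
  moreover have "\<forall>a\<in>?J. \<forall>b\<in>M. (b, a) \<in> r \<longrightarrow> b \<in> ?J"
    unfolding down_closure_def by (auto intro: order_trans)
  moreover have "mul w g t \<in> ?J" "mul t g w \<in> ?J" if t: "t \<in> ?J" and w: "w \<in> M" "g \<in> \<Gamma>" for w g t
  proof -
    obtain h where h: "t \<in> M" "h \<in> H" "(t, h) \<in> r"
      using t unfolding down_closure_def by blast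
    have "h \<in> M"
      using h assms(1) by blast
    \<comment> \<open>The products with \<open>h\<close> lie in \<open>H\<close> by
      \<open>left\<close> and \<open>right\<close>, so they are the upper bounds that put the
      products with \<open>t\<close> into \<open>?J\<close>.\<close>
    then have "(mul w g t, mul w g h) \<in> r" "(mul t g w, mul h g w) \<in> r"
      using h w by (simp_all add: mul_mono_left mul_mono_right)
    then show "mul w g t \<in> ?J" "mul t g w \<in> ?J"
      using h w left right unfolding down_closure_def by (auto simp: mul_closed)
  qed
  ultimately show ?thesis
    unfolding gamma_ideal_def left_ideal_def right_ideal_def gamma_prod_def by auto
qed

lemma gamma_ideal_down_closure_two_sided_multiples:
  assumes "p \<in> M"
  shows "gamma_ideal M \<Gamma> mul r (down_closure M r (two_sided_multiples p))"
proof (rule gamma_ideal_down_closure)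
  show "two_sided_multiples p \<noteq> {}"
    using M_nonempty Gamma_nonempty unfolding two_sided_multiples_def by fast
qed (use assms in \<open>simp_all add: two_sided_multiples_subset two_sided_multiples_mul_left
      two_sided_multiples_mul_right\<close>)

lemma intra_regular_iff:
  "intra_regular M \<Gamma> mul r \<longleftrightarrow>
    (\<forall>x\<in>M. \<forall>g\<in>\<Gamma>. x \<in> down_closure M r (two_sided_multiples (mul x g x)))"
  unfolding intra_regular_def two_sided_multiples_def ..

text \<open>Each element arises from \<open>p\<close> by one left and one right multiplication, and
  an ideal absorbs both.\<close>

lemma two_sided_multiples_subset_ideal:
  assumes "gamma_ideal M \<Gamma> mul r A" "p \<in> A"
  shows "two_sided_multiples p \<subseteq> A"
proof -
  have left: "\<And>u l q. \<lbrakk>u \<in> M; l \<in> \<Gamma>; q \<in> A\<rbrakk> \<Longrightarrow> mul u l q \<in> A"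
    and right: "\<And>q m v. \<lbrakk>q \<in> A; m \<in> \<Gamma>; v \<in> M\<rbrakk> \<Longrightarrow> mul q m v \<in> A"
    using assms unfolding gamma_ideal_def left_ideal_def right_ideal_def gamma_prod_def by blast+
  then show ?thesis
    using assms(2) unfolding two_sided_multiples_def by auto
qed

text \<open>Intra-regularity puts \<open>x\<close> below an element of M\<Gamma>(x g x)\<Gamma>M.
  That set lies in \<open>A\<close> once \<open>mul x g x\<close> does, and \<open>A\<close> is
  downward closed.\<close>

lemma intra_regular_imp_semiprime:
  assumes "intra_regular M \<Gamma> mul r" and A: "gamma_ideal M \<Gamma> mul r A"
  shows "semiprime M \<Gamma> mul A"
  unfolding semiprime_def
proof (intro ballI impI)
  fix x g assume x: "x \<in> M" "g \<in> \<Gamma>" "mul x g x \<in> A"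
  then obtain h where "h \<in> two_sided_multiples (mul x g x)" "(x, h) \<in> r"
    using assms(1) unfolding intra_regular_iff down_closure_def by blast
  moreover have "two_sided_multiples (mul x g x) \<subseteq> A"
    using A x(3) by (rule two_sided_multiples_subset_ideal)
  ultimately show "x \<in> A"
    using A x(1) unfolding gamma_ideal_def left_ideal_def by blast
qed

lemma semiprime_imp_intra_regular:
  assumes "\<And>A. gamma_ideal M \<Gamma> mul r A \<Longrightarrow> semiprime M \<Gamma> mul A"
  shows "intra_regular M \<Gamma> mul r"
  unfolding intra_regular_iff
proof (intro ballI)
  fix x g assume x: "x \<in> M" "g \<in> \<Gamma>"
  let ?p = "mul x g x"
  let ?J = "down_closure M r (two_sided_multiples ?p)"
  have p: "?p \<in> M"
    using x by (simp add: mul_closed)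
  have J: "semiprime M \<Gamma> mul ?J"
    using assms gamma_ideal_down_closure_two_sided_multiples p by blast
  \<comment> \<open>Without an identity element, \<open>?p\<close> itself need not lie in
    M\<Gamma>p\<Gamma>M, so the argument starts from its square, where \<open>x\<close> serves as
    both outer factors and \<open>g\<close> as both operators.\<close>
  have "mul ?p g ?p = mul (mul x g ?p) g x"
    using x by (simp add: mul_assoc mul_closed)
  then have "mul ?p g ?p \<in> two_sided_multiples ?p"
    using x by (simp add: two_sided_multiplesI)
  then have "mul ?p g ?p \<in> ?J"
    using p x unfolding down_closure_def by (auto intro: order_refl mul_closed)
  \<comment> \<open>Semiprimeness is applied twice with the same \<open>g\<close>: first to
    \<open>?p\<close>, then to \<open>x\<close>, whose square is \<open>?p\<close>.\<close>
  then show "x \<in> ?J"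
    using J p x unfolding semiprime_def by blast
qed

end

theorem theorem3:
  fixes M :: "'a set" and \<Gamma> :: "'g set"
    and mul :: "'a \<Rightarrow> 'g \<Rightarrow> 'a \<Rightarrow> 'a" and r :: "('a \<times> 'a) set"
  assumes "ordered_gamma_semigroup M \<Gamma> mul r"
  shows "intra_regular M \<Gamma> mul r \<longleftrightarrow>
    (\<forall>A. gamma_ideal M \<Gamma> mul r A \<longrightarrow> semiprime M \<Gamma> mul A)"
proof -
  interpret ordered_gamma_semigroup M \<Gamma> mul r
    by (fact assms)
  show ?thesis
    using intra_regular_imp_semiprime semiprime_imp_intra_regular by blast
qed

end
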